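(* The cactus groups $J_n$ have no odd torsion (no element of odd order greater than $1$). Moreover, for every $k\ge 1$, $J_n$ contains elements of order $2^k$ provided that $n$ is big enough.
   Context: For $n \ge 2$, the cactus group $J_n$ is the group with generators $s_{p,q}$ for $1 \le p < q \le n$ and relations: (j1) $s_{p,q}^2 = 1$; (j2) $s_{p,q}s_{m,r} = s_{m,r}s_{p,q}$ whenever $[p,q]\cap[m,r]=\emptyset$; (j3) $s_{p,q}s_{m,r} = s_{p+q-r,\,p+q-m}\,s_{p,q}$ whenever $[m,r]\subset[p,q]$ (intervals of integers). *)

theory Defs
  imports "HOL-Algebra.Multiplicative_Group"
begin

section \<open>Groups given by generators and relations\<close>

text \<open>A letter \<open>(s, True)\<close> stands for the generator \<open>s\<close>, and \<open>(s, False)\<close> for its formal inverse.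
  A relation \<open>u = v\<close> is represented by the pair of words \<open>(u, v)\<close>.\<close>

type_synonym 'a group_word = "('a \<times> bool) list"

abbreviation words_over :: "'a set \<Rightarrow> 'a group_word set" where
  "words_over S \<equiv> lists (S \<times> UNIV)"

abbreviation gen_word :: "'a \<Rightarrow> 'a group_word" where
  "gen_word s \<equiv> [(s, True)]"

inductive_set word_cong ::
    "'a set \<Rightarrow> ('a group_word \<times> 'a group_word) set \<Rightarrow> ('a group_word \<times> 'a group_word) set"
  for S :: "'a set" and R :: "('a group_word \<times> 'a group_word) set"
where
  refl: "u \<in> words_over S \<Longrightarrow> (u, u) \<in> word_cong S R"
| sym: "(u, v) \<in> word_cong S R \<Longrightarrow> (v, u) \<in> word_cong S R"
| trans: "\<lbrakk>(u, v) \<in> word_cong S R; (v, w) \<in> word_cong S R\<rbrakk> \<Longrightarrow> (u, w) \<in> word_cong S R"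
| append: "\<lbrakk>(u, v) \<in> word_cong S R; (u', v') \<in> word_cong S R\<rbrakk> \<Longrightarrow> (u @ u', v @ v') \<in> word_cong S R"
| cancel: "s \<in> S \<Longrightarrow> ([(s, b), (s, \<not> b)], []) \<in> word_cong S R"
| rel: "\<lbrakk>(u, v) \<in> R; u \<in> words_over S; v \<in> words_over S\<rbrakk> \<Longrightarrow> (u, v) \<in> word_cong S R"

definition presented_group ::
    "'a set \<Rightarrow> ('a group_word \<times> 'a group_word) set \<Rightarrow> 'a group_word set monoid" where
  "presented_group S R =
    \<lparr>carrier = words_over S // word_cong S R,
     mult = (\<lambda>X Y. \<Union>x\<in>X. \<Union>y\<in>Y. word_cong S R `` {x @ y}),
     one = word_cong S R `` {[]}\<rparr>"

lemma word_cong_words: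
  "(u, v) \<in> word_cong S R \<Longrightarrow> u \<in> words_over S \<and> v \<in> words_over S"
  by (induction rule: word_cong.induct) auto

lemma equiv_word_cong: "equiv (words_over S) (word_cong S R)"
proof (rule equivI)
  show "word_cong S R \<subseteq> words_over S \<times> words_over S"
    by (auto dest: word_cong_words)
  show "refl_on (words_over S) (word_cong S R)"
    by (auto intro!: refl_onI word_cong.refl)
  show "Relation.sym (word_cong S R)"
    by (rule symI) (rule word_cong.sym)
  show "Relation.trans (word_cong S R)"
    by (rule transI) (rule word_cong.trans)
qed

lemma presented_group_mult_class:
  assumes "u \<in> words_over S" "v \<in> words_over S"
  shows "mult (presented_group S R) (word_cong S R `` {u}) (word_cong S R `` {v})
       = word_cong S R `` {u @ v}"
proof -
  have c: "word_cong S R `` {x @ y} = word_cong S R `` {u @ v}"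
    if "(u, x) \<in> word_cong S R" "(v, y) \<in> word_cong S R" for x y
    using equiv_class_eq[OF equiv_word_cong word_cong.append[OF that]] by simp
  have u: "u \<in> word_cong S R `` {u}" and v: "v \<in> word_cong S R `` {v}"
    using assms by (simp_all add: word_cong.refl)
  have "(\<Union>y\<in>word_cong S R `` {v}. word_cong S R `` {x @ y}) = word_cong S R `` {u @ v}"
    if x: "x \<in> word_cong S R `` {u}" for x
    by (rule UN_constant_eq[OF v]) (use c x in simp)
  then have "(\<Union>x\<in>word_cong S R `` {u}. \<Union>y\<in>word_cong S R `` {v}. word_cong S R `` {x @ y})
      = word_cong S R `` {u @ v}"
    by (intro UN_constant_eq[OF u] ballI)
  then show ?thesis
    by (simp add: presented_group_def)
qed

lemma word_cong_inverse:
  "u \<in> words_over S \<Longrightarrow>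
    (rev (map (\<lambda>(s, b). (s, \<not> b)) u) @ u, []) \<in> word_cong S R"
proof (induction u)
  case Nil
  then show ?case by (auto intro: word_cong.refl)
next
  case (Cons a u)
  obtain s b where a: "a = (s, b)" by force
  let ?i = "rev (map (\<lambda>(s, b). (s, \<not> b)) u)"
  have s: "s \<in> S" and u: "u \<in> words_over S" using Cons.prems a by auto
  have i: "?i \<in> words_over S" using u by (auto simp: in_lists_conv_set)
  have "([(s, \<not> b), (s, b)] @ u, [] @ u) \<in> word_cong S R"
    using word_cong.cancel[OF s, of "\<not> b" R] u
    by (intro word_cong.append word_cong.refl) auto
  from word_cong.append[OF word_cong.refl[OF i] this]
  have "(?i @ [(s, \<not> b), (s, b)] @ u, ?i @ u) \<in> word_cong S R" by simp
  from word_cong.trans[OF this Cons.IH[OF u]] show ?case by (simp add: a)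
qed

lemma group_presented_group: "group (presented_group S R)"
proof (rule groupI)
  let ?G = "presented_group S R" and ?W = "words_over S"
  let ?c = "\<lambda>u. word_cong S R `` {u}"
  have carr: "carrier ?G = ?c ` ?W"
    by (auto simp: presented_group_def quotient_def)
  have rep: "\<exists>u. u \<in> ?W \<and> x = ?c u" if "x \<in> carrier ?G" for x
    using that unfolding carr image_iff Bex_def .
  have one: "\<one>\<^bsub>?G\<^esub> = ?c []"
    by (simp add: presented_group_def)
  show "x \<otimes>\<^bsub>?G\<^esub> y \<in> carrier ?G" if xy: "x \<in> carrier ?G" "y \<in> carrier ?G" for x y
  proof -
    obtain u v where "u \<in> ?W" "v \<in> ?W" "x = ?c u" "y = ?c v"
      using xy[THEN rep] by metis
    then show ?thesis unfolding carr
      by (intro image_eqI[of _ _ "u @ v"]) (simp_all add: presented_group_mult_class)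
  qed
  show "\<one>\<^bsub>?G\<^esub> \<in> carrier ?G"
    unfolding carr one by (rule imageI) simp
  show "x \<otimes>\<^bsub>?G\<^esub> y \<otimes>\<^bsub>?G\<^esub> z = x \<otimes>\<^bsub>?G\<^esub> (y \<otimes>\<^bsub>?G\<^esub> z)"
    if xyz: "x \<in> carrier ?G" "y \<in> carrier ?G" "z \<in> carrier ?G" for x y z
  proof -
    obtain u v w where "u \<in> ?W" "v \<in> ?W" "w \<in> ?W" "x = ?c u" "y = ?c v" "z = ?c w"
      using xyz[THEN rep] by metis
    then show ?thesis by (simp add: presented_group_mult_class)
  qed
  show "\<one>\<^bsub>?G\<^esub> \<otimes>\<^bsub>?G\<^esub> x = x" if x: "x \<in> carrier ?G" for x
  proof -
    obtain u where "u \<in> ?W" "x = ?c u" using x[THEN rep] by metis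
    then show ?thesis by (simp add: one presented_group_mult_class)
  qed
  show "\<exists>y\<in>carrier ?G. y \<otimes>\<^bsub>?G\<^esub> x = \<one>\<^bsub>?G\<^esub>" if x: "x \<in> carrier ?G" for x
  proof -
    obtain u where u: "u \<in> ?W" "x = ?c u" using x[THEN rep] by metis
    let ?i = "rev (map (\<lambda>(s, b). (s, \<not> b)) u)"
    have i: "?i \<in> ?W" using u(1) by (auto simp: in_lists_conv_set)
    have "?c ?i \<otimes>\<^bsub>?G\<^esub> x = ?c (?i @ u)"
      using presented_group_mult_class[OF i u(1)] u(2) by simp
    also have "\<dots> = \<one>\<^bsub>?G\<^esub>"
      using equiv_class_eq[OF equiv_word_cong word_cong_inverse[OF u(1)]] by (simp add: one)
    finally show ?thesis
      by (rule bexI) (unfold carr, rule imageI, rule i)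
  qed
qed

section \<open>Cactus groups\<close>

text \<open>The pair \<open>(p, q)\<close> stands for the generator \<open>s\<^bsub>p,q\<^esub>\<close>. In the third family of relations
  the truncated subtractions are harmless, because \<open>m < r \<le> q\<close> there.\<close>

definition cactus_gens :: "nat \<Rightarrow> (nat \<times> nat) set" where
  "cactus_gens n = {(p, q). 1 \<le> p \<and> p < q \<and> q \<le> n}"

definition cactus_rels :: "nat \<Rightarrow> ((nat \<times> nat) group_word \<times> (nat \<times> nat) group_word) set" where
  "cactus_rels n =
     {(gen_word (p, q) @ gen_word (p, q), []) | p q. (p, q) \<in> cactus_gens n}
   \<union> {(gen_word (p, q) @ gen_word (m, r), gen_word (m, r) @ gen_word (p, q)) | p q m r.
        (p, q) \<in> cactus_gens n \<and> (m, r) \<in> cactus_gens n \<and> {p..q} \<inter> {m..r} = {}}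
   \<union> {(gen_word (p, q) @ gen_word (m, r), gen_word (p + q - r, p + q - m) @ gen_word (p, q)) | p q m r.
        (p, q) \<in> cactus_gens n \<and> (m, r) \<in> cactus_gens n \<and> {m..r} \<subseteq> {p..q}}"

definition cactus_group :: "nat \<Rightarrow> (nat \<times> nat) group_word set monoid" where
  "cactus_group n = presented_group (cactus_gens n) (cactus_rels n)"

lemma group_cactus_group: "group (cactus_group n)"
  unfolding cactus_group_def by (rule group_presented_group)

lemma cactus_rels_words:
  "cactus_rels n \<subseteq> words_over (cactus_gens n) \<times> words_over (cactus_gens n)"
  by (auto simp: cactus_rels_def cactus_gens_def)

end

theory Submission
  imports Defs "HOL-Computational_Algebra.Primes"
begin

text \<open>
  Let \<open>G\<^sub>l\<close> be the group presented by the generators \<open>s\<^bsub>p,q\<^esub>\<close> with \<open>q - p \<ge> l\<close> and the cactus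
  relations among them, so that \<open>G\<^sub>0 = J\<^sub>n\<close> and \<open>G\<^sub>n\<close> is trivial. Killing the generators with
  \<open>q - p = l\<close> gives a split surjection from \<open>G\<^sub>l\<close> onto \<open>G\<^bsub>l+1\<^esub>\<close> whose kernel \<open>N\<close> is generated by the
  conjugates of these generators under the longer ones. It therefore suffices that \<open>N\<close> has no odd
  torsion.

  \<open>N\<close> is a right-angled Coxeter group, and the argument is a dual form of the Magnus expansion
  \<open>v \<mapsto> 1 + X\<^sub>v\<close> over the field with two elements, where \<open>X\<^sub>v\<^sup>2 = 0\<close> and \<open>X\<^sub>v\<close>, \<open>X\<^sub>w\<close> commute
  whenever \<open>v\<close>, \<open>w\<close> do. Here \<open>X\<^sub>v\<close> acts on functions of words by \<open>(X\<^sub>v f)(u) = f(u v)\<close>.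
  This action is unipotent in characteristic two, so an element of odd order acts trivially; on the
  other hand a nonempty word that cannot be shortened by commutations and cancellation of
  squares moves the indicator function of its commutation class.

  The element \<open>s\<^bsub>1,2^k\<^esub> \<dots> s\<^bsub>1,4\<^esub> s\<^bsub>1,2\<^esub>\<close> has order \<open>2^k\<close>: the square of
  \<open>s\<^bsub>1,2^k\<^esub> x\<close> is the product of \<open>x\<close> and its commuting mirror image, and
  the action on \<open>{1..2^k}\<close> shows that the order is not smaller.
\<close>

section \<open>Functions on words and transvections\<close>

definition swap_step :: "('v \<Rightarrow> 'v \<Rightarrow> bool) \<Rightarrow> 'v list \<Rightarrow> 'v list \<Rightarrow> bool" where
  "swap_step comm u v \<longleftrightarrow> (\<exists>a b x y. comm x y \<and> u = a @ [x, y] @ b \<and> v = a @ [y, x] @ b)"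

text \<open>Booleans stand for the field with two elements, and \<open>f\<close> for a linear
  functional on noncommutative polynomials, given by its values on monomials. It has to vanish on
  the ideal generated by the squares of letters and the commutators of letters related by
  \<open>comm\<close>.\<close>

definition trace_funs :: "('v \<Rightarrow> 'v \<Rightarrow> bool) \<Rightarrow> ('v list \<Rightarrow> bool) set" where
  "trace_funs comm = {f. (\<forall>a b x y. comm x y \<longrightarrow> f (a @ [x, y] @ b) = f (a @ [y, x] @ b))
                       \<and> (\<forall>a b x. \<not> f (a @ [x, x] @ b))}"

definition letter_op :: "'v \<Rightarrow> ('v list \<Rightarrow> bool) \<Rightarrow> 'v list \<Rightarrow> bool" where
  "letter_op v f u \<longleftrightarrow> f u \<noteq> f (u @ [v])"

text \<open>Expanding the product of the factors \<open>1 + X_v\<close> shows that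
  \<open>list_op vs f u\<close> is the sum modulo 2 of \<open>f (u @ ws)\<close> over all
  subsequences \<open>ws\<close> of \<open>vs\<close>, counted with multiplicity.\<close>

primrec list_op :: "'v list \<Rightarrow> ('v list \<Rightarrow> bool) \<Rightarrow> 'v list \<Rightarrow> bool" where
  "list_op [] f = f"
| "list_op (v # vs) f = letter_op v (list_op vs f)"

lemma trace_funsI:
  assumes "\<And>a b x y. comm x y \<Longrightarrow> f (a @ [x, y] @ b) = f (a @ [y, x] @ b)"
    and "\<And>a b x. \<not> f (a @ [x, x] @ b)"
  shows "f \<in> trace_funs comm"
  using assms unfolding trace_funs_def by blast

lemma trace_funs_swap:
  "f \<in> trace_funs comm \<Longrightarrow> comm x y \<Longrightarrow> f (a @ [x, y] @ b) = f (a @ [y, x] @ b)"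
  unfolding trace_funs_def by blast

lemma trace_funs_square: "f \<in> trace_funs comm \<Longrightarrow> \<not> f (a @ [x, x] @ b)"
  unfolding trace_funs_def by blast

lemma trace_funs_letter_op:
  assumes "f \<in> trace_funs comm" shows "letter_op v f \<in> trace_funs comm"
proof (rule trace_funsI)
  show "letter_op v f (a @ [x, y] @ b) = letter_op v f (a @ [y, x] @ b)" if "comm x y" for a b x y
    using trace_funs_swap[OF assms that, of a b] trace_funs_swap[OF assms that, of a "b @ [v]"]
    by (simp add: letter_op_def)
  show "\<not> letter_op v f (a @ [x, x] @ b)" for a b x
    using trace_funs_square[OF assms, of a x b] trace_funs_square[OF assms, of a x "b @ [v]"]
    by (simp add: letter_op_def)
qed

lemma trace_funs_list_op: "f \<in> trace_funs comm \<Longrightarrow> list_op vs f \<in> trace_funs comm"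
  by (induction vs) (auto intro: trace_funs_letter_op)

lemma letter_op_involution:
  assumes "f \<in> trace_funs comm" shows "letter_op v (letter_op v f) = f"
  using trace_funs_square[OF assms, of _ v "[]"] by (auto simp: letter_op_def fun_eq_iff)

lemma letter_op_commute:
  assumes "f \<in> trace_funs comm" "comm x y"
  shows "letter_op x (letter_op y f) = letter_op y (letter_op x f)"
  using trace_funs_swap[OF assms, of _ "[]"] by (auto simp: letter_op_def fun_eq_iff)

lemma list_op_append: "list_op (vs @ ws) f = list_op vs (list_op ws f)"
  by (induction vs) simp_all

lemma list_op_replicate: "list_op (concat (replicate m vs)) = list_op vs ^^ m"
proof (induction m)
  case (Suc m)
  show ?case by (rule ext) (simp add: list_op_append Suc.IH)
qed (simp add: fun_eq_iff)

lemma list_op_xor: "list_op vs (\<lambda>u. f u \<noteq> g u) = (\<lambda>u. list_op vs f u \<noteq> list_op vs g u)"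
  by (induction vs) (auto simp: letter_op_def fun_eq_iff)

lemma list_op_funpow_xor:
  "(list_op vs ^^ m) (\<lambda>u. f u \<noteq> g u) = (\<lambda>u. (list_op vs ^^ m) f u \<noteq> (list_op vs ^^ m) g u)"
  unfolding list_op_replicate[symmetric] by (rule list_op_xor)

text \<open>Besides \<open>u\<close> itself, only proper extensions of \<open>u\<close> enter the
  sum, and these have length at least \<open>d\<close>.\<close>

lemma list_op_support:
  assumes "\<And>u. d \<le> length u \<Longrightarrow> \<not> f u" "d \<le> Suc (length u)"
  shows "list_op vs f u = f u"
  using assms(2)
proof (induction vs arbitrary: u)
  case (Cons v vs)
  then show ?case using assms(1)[of "u @ [v]"] by (simp add: letter_op_def)
qed simp

text \<open>Each operator \<open>list_op vs\<close> is unipotent in characteristic two with respect to the filtration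
  by the length of the support, so its order on each filtration step is a power of two.\<close>

lemma list_op_funpow_two_power:
  assumes "\<And>u. d \<le> length u \<Longrightarrow> \<not> f u"
  shows "(list_op vs ^^ (2 ^ d)) f = f"
  using assms
proof (induction d arbitrary: f)
  case 0
  then show ?case by (auto simp: fun_eq_iff list_op_support[where d = 0])
next
  case (Suc d)
  let ?T = "list_op vs ^^ (2 ^ d)"
  let ?g = "\<lambda>u. ?T f u \<noteq> f u"
  have "?T f u = f u" if "d \<le> length u" for u
    unfolding list_op_replicate[symmetric]
    by (rule list_op_support[of "Suc d"]) (use Suc.prems that in auto)
  \<comment> \<open>The difference \<open>?g\<close> of \<open>?T f\<close> and \<open>f\<close>
    lives on words shorter than \<open>d\<close>, so \<open>?T\<close> fixes it. Modulo 2 this reads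
    \<open>?T (?T f) + ?T f = ?T f + f\<close>.\<close>
  then have g: "?T ?g = ?g" by (intro Suc.IH) simp
  have "?T (?T f) u = f u" for u
    using fun_cong[OF g, of u] unfolding list_op_funpow_xor by blast
  then have "?T (?T f) = f" by (rule ext)
  moreover have "(list_op vs ^^ (2 ^ Suc d)) f = ?T (?T f)"
    by (simp add: mult_2 funpow_add)
  ultimately show ?case by simp
qed

lemma funpow_fixpoint_coprime:
  assumes "(T ^^ a) f = f" "(T ^^ b) f = f" "coprime a b" "a \<noteq> 0"
  shows "T f = f"
proof -
  have iter: "(T ^^ (c * k)) f = f" if "(T ^^ c) f = f" for c k :: nat
    using that by (induction k) (simp_all add: funpow_add)
  obtain x y where "a * x = b * y + gcd a b" using bezout_nat[OF assms(4)] by blast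
  then have "a * x = Suc (b * y)" using assms(3) by simp
  then have "f = (T ^^ Suc (b * y)) f" using iter[OF assms(1), of x] by simp
  then show ?thesis using iter[OF assms(2), of y] by simp
qed

text \<open>Among the subsequences of \<open>vs\<close>, at most the full word takes
  \<open>u\<close> up to the degree \<open>k\<close> in which \<open>f\<close> lives.\<close>

lemma list_op_homogeneous:
  assumes "\<And>u. f u \<Longrightarrow> length u = k"
  shows "(length u + length vs < k \<longrightarrow> \<not> list_op vs f u) \<and>
         (length u + length vs = k \<longrightarrow> list_op vs f u = f (u @ vs))"
proof (induction vs arbitrary: u)
  case Nil
  then show ?case using assms by auto
next
  case (Cons v vs)
  show ?case using Cons.IH[of u] Cons.IH[of "u @ [v]"] by (auto simp: letter_op_def)
qed

lemma swap_steps_length: "(swap_step comm)\<^sup>*\<^sup>* u v \<Longrightarrow> length v = length u"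
  by (induction rule: rtranclp_induct) (auto simp: swap_step_def)

lemma swap_steps_set: "(swap_step comm)\<^sup>*\<^sup>* u v \<Longrightarrow> set v = set u"
proof (induction rule: rtranclp_induct)
  case (step y z)
  then obtain a b p q where "y = a @ [p, q] @ b" "z = a @ [q, p] @ b" by (auto simp: swap_step_def)
  then have "set z = set y" by (simp add: insert_commute)
  with step.IH show ?case by simp
qed simp

text \<open>If no word in the commutation class of \<open>vs\<close> contains a square, the
  indicator function of this class is a trace function. It is fixed by an odd power and by a power
  of two of \<open>list_op vs\<close>, hence by \<open>list_op vs\<close> itself. At the empty word,
  however, the operator yields the value at \<open>vs\<close>, which is true, while the indicator is
  false there.\<close>

lemma odd_power_acts_trivially_imp_square:
  assumes sym: "\<And>x y. comm x y \<Longrightarrow> comm y x"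
    and triv: "\<And>f. f \<in> trace_funs comm \<Longrightarrow> list_op (concat (replicate m vs)) f = f"
    and m: "odd m" and vs: "vs \<noteq> []"
  obtains a x b where "(swap_step comm)\<^sup>*\<^sup>* vs (a @ [x, x] @ b)"
proof (rule ccontr)
  assume "\<not> thesis"
  then have nosq: "\<not> (swap_step comm)\<^sup>*\<^sup>* vs (a @ [x, x] @ b)" for a x b using that by blast
  define f where "f = (swap_step comm)\<^sup>*\<^sup>* vs"
  have step: "f (a @ [y, x] @ b)" if "comm x y" "f (a @ [x, y] @ b)" for a b x y
    using that unfolding f_def swap_step_def by (blast intro: rtranclp.rtrancl_into_rtrancl)
  have fF: "f \<in> trace_funs comm"
  proof (rule trace_funsI)
    show "f (a @ [x, y] @ b) = f (a @ [y, x] @ b)" if "comm x y" for a b x y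
      using step[OF that] step[OF sym[OF that]] by blast
    show "\<not> f (a @ [x, x] @ b)" for a b x using nosq by (simp add: f_def)
  qed
  have len: "length u = length vs" if "f u" for u
    using that swap_steps_length by (auto simp: f_def)
  have "(list_op vs ^^ m) f = f" using triv[OF fF] by (simp add: list_op_replicate)
  \<comment> \<open>All words of the class have the length of \<open>vs\<close>, so the support lies
    strictly below \<open>Suc (length vs)\<close>.\<close>
  moreover have "(list_op vs ^^ (2 ^ Suc (length vs))) f = f"
    by (rule list_op_funpow_two_power) (use len in fastforce)
  moreover have "coprime m (2 ^ Suc (length vs))" using m by simp
  moreover have "m \<noteq> 0" using m by (intro notI) simp
  ultimately have "list_op vs f = f" by (rule funpow_fixpoint_coprime)
  moreover have "list_op vs f [] = f vs"
    using list_op_homogeneous[of f "length vs" "[]" vs] len by simp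
  moreover have "f vs" by (simp add: f_def)
  ultimately have "f []" by simp
  then show False using len[of "[]"] vs by simp
qed

section \<open>Odd torsion in groups generated by involutions\<close>

definition group_prod :: "('a, 'b) monoid_scheme \<Rightarrow> 'a list \<Rightarrow> 'a" where
  "group_prod G vs = foldr (\<otimes>\<^bsub>G\<^esub>) vs \<one>\<^bsub>G\<^esub>"

text \<open>Commutation is taken in the group, not read off defining relations. Thus every swap
  preserves products, and conjugation preserves the relation.\<close>

definition group_comm :: "('a, 'b) monoid_scheme \<Rightarrow> 'a \<Rightarrow> 'a \<Rightarrow> bool" where
  "group_comm G x y \<longleftrightarrow> x \<in> carrier G \<and> y \<in> carrier G \<and> x \<otimes>\<^bsub>G\<^esub> y = y \<otimes>\<^bsub>G\<^esub> x"

definition no_odd_torsion :: "('a, 'b) monoid_scheme \<Rightarrow> bool" where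
  "no_odd_torsion G \<longleftrightarrow>
    (\<forall>x\<in>carrier G. \<forall>m::nat. odd m \<longrightarrow> x [^]\<^bsub>G\<^esub> m = \<one>\<^bsub>G\<^esub> \<longrightarrow> x = \<one>\<^bsub>G\<^esub>)"

context group
begin

lemma group_prod_closed: "vs \<in> lists (carrier G) \<Longrightarrow> group_prod G vs \<in> carrier G"
  by (induction vs) (auto simp: group_prod_def)

lemma group_prod_append:
  "us \<in> lists (carrier G) \<Longrightarrow> vs \<in> lists (carrier G) \<Longrightarrow>
    group_prod G (us @ vs) = group_prod G us \<otimes> group_prod G vs"
  using group_prod_closed
  by (induction us) (auto simp: group_prod_def m_assoc)

lemma group_prod_Cons: "group_prod G (x # vs) = x \<otimes> group_prod G vs"
  by (simp add: group_prod_def)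

lemma group_prod_Nil: "group_prod G [] = \<one>"
  by (simp add: group_prod_def)

lemma group_prod_pair: "x \<in> carrier G \<Longrightarrow> y \<in> carrier G \<Longrightarrow> group_prod G [x, y] = x \<otimes> y"
  by (simp add: group_prod_def)

lemma group_prod_replicate:
  assumes "vs \<in> lists (carrier G)"
  shows "group_prod G (concat (replicate m vs)) = group_prod G vs [^] m"
proof (induction m)
  case (Suc m)
  have "concat (replicate m vs) \<in> lists (carrier G)" using assms by (auto simp: in_lists_conv_set)
  with Suc assms show ?case
    using group_prod_closed[OF assms]
    by (simp add: group_prod_append nat_pow_Suc2[symmetric] del: nat_pow_Suc)
qed (simp add: group_prod_Nil)

lemma group_prod_swap_steps:
  assumes "(swap_step (group_comm G))\<^sup>*\<^sup>* us vs" "us \<in> lists (carrier G)"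
  shows "group_prod G us = group_prod G vs"
proof -
  have "vs \<in> lists (carrier G) \<and> group_prod G us = group_prod G vs"
    using assms
  proof (induction rule: rtranclp_induct)
    case (step y z)
    then obtain a b p q where pq: "group_comm G p q" and yz: "y = a @ [p, q] @ b" "z = a @ [q, p] @ b"
      by (auto simp: swap_step_def)
    have y: "y \<in> lists (carrier G)" "group_prod G us = group_prod G y" using step by auto
    have "group_prod G [p, q] = group_prod G [q, p]"
      using pq by (simp only: group_comm_def group_prod_pair)
    moreover have "group_prod G y = group_prod G a \<otimes> (group_prod G [p, q] \<otimes> group_prod G b)"
      "group_prod G z = group_prod G a \<otimes> (group_prod G [q, p] \<otimes> group_prod G b)"
      using y(1) unfolding yz by (simp_all add: group_prod_append del: append_Cons append_Nil)
    ultimately have "group_prod G us = group_prod G z" using y(2) by (simp only:)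
    moreover have "z \<in> lists (carrier G)" using y(1) unfolding yz by simp
    ultimately show ?case by (intro conjI)
  qed simp
  then show ?thesis ..
qed

text \<open>Induction on the length of the word: its \<open>m\<close>-fold repetition has trivial
  product and so acts trivially, hence swaps expose a square in \<open>vs\<close>. Deleting that
  square keeps the product and shortens the word.\<close>

lemma odd_torsion_trivial_if_list_op_faithful:
  assumes V: "V \<subseteq> carrier G" "\<And>v. v \<in> V \<Longrightarrow> v \<otimes> v = \<one>"
    and act: "\<And>us f. us \<in> lists V \<Longrightarrow> group_prod G us = \<one> \<Longrightarrow> f \<in> trace_funs (group_comm G) \<Longrightarrow>
                list_op us f = f"
    and m: "odd (m::nat)" and vs: "vs \<in> lists V" "group_prod G vs [^] m = \<one>"
  shows "group_prod G vs = \<one>"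
  using vs
proof (induction "length vs" arbitrary: vs rule: less_induct)
  case less
  have VC: "us \<in> lists (carrier G)" if "us \<in> lists V" for us using that V(1) by blast
  show ?case
  proof (cases "vs = []")
    case True
    then show ?thesis by (simp add: group_prod_Nil)
  next
    case False
    have "concat (replicate m vs) \<in> lists V" using less.prems(1) by (auto simp: in_lists_conv_set)
    then have triv: "list_op (concat (replicate m vs)) f = f" if "f \<in> trace_funs (group_comm G)" for f
      using act that less.prems(2) group_prod_replicate[OF VC[OF less.prems(1)]] by simp
    have sym: "group_comm G y x" if "group_comm G x y" for x y using that by (simp add: group_comm_def)
    obtain a x b where sw: "(swap_step (group_comm G))\<^sup>*\<^sup>* vs (a @ [x, x] @ b)"
      by (rule odd_power_acts_trivially_imp_square[where comm = "group_comm G" and m = m and vs = vs])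
        (use sym triv m False in blast)+
    have inV: "x \<in> V" "a \<in> lists V" "b \<in> lists V"
      using swap_steps_set[OF sw] less.prems(1) by (auto simp: in_lists_conv_set)
    have "x \<in> carrier G" using inV(1) V(1) by blast
    then have "group_prod G (a @ [x, x] @ b) = group_prod G (a @ b)"
      using VC[OF inV(2)] VC[OF inV(3)] V(2)[OF inV(1)]
      by (simp add: group_prod_append group_prod_Cons m_assoc[symmetric] group_prod_closed)
    then have eq: "group_prod G vs = group_prod G (a @ b)"
      using group_prod_swap_steps[OF sw VC[OF less.prems(1)]] by simp
    show ?thesis unfolding eq
      by (rule less.hyps) (use swap_steps_length[OF sw] inV less.prems(2) eq in auto)
  qed
qed

section \<open>Conjugation acting on words of group elements\<close>

text \<open>Being the identity outside the carrier, it satisfies \<open>conj_map_mult\<close> and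
  \<open>conj_map_one\<close> at every letter.\<close>

definition conj_map :: "'a \<Rightarrow> 'a \<Rightarrow> 'a" where
  "conj_map g x = (if x \<in> carrier G then g \<otimes> x \<otimes> inv g else x)"

definition conj_op :: "'a \<Rightarrow> ('a list \<Rightarrow> bool) \<Rightarrow> 'a list \<Rightarrow> bool" where
  "conj_op g f u = f (map (conj_map g) u)"

lemma conj_map_mult:
  "g \<in> carrier G \<Longrightarrow> h \<in> carrier G \<Longrightarrow> conj_map g (conj_map h x) = conj_map (g \<otimes> h) x"
  by (simp add: conj_map_def m_assoc inv_mult_group)

lemma conj_map_one: "conj_map \<one> = id"
  by (auto simp: conj_map_def fun_eq_iff)

lemma conj_map_group_comm:
  assumes "g \<in> carrier G" "group_comm G x y"
  shows "group_comm G (conj_map g x) (conj_map g y)"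
proof -
  have xy: "x \<in> carrier G" "y \<in> carrier G" "x \<otimes> y = y \<otimes> x" using assms by (auto simp: group_comm_def)
  have mult: "conj_map g a \<otimes> conj_map g b = conj_map g (a \<otimes> b)"
    if "a \<in> carrier G" "b \<in> carrier G" for a b
    \<comment> \<open>After reassociation this instance cancels \<open>inv g\<close> against
      \<open>g\<close> in the middle of the product.\<close>
    using assms(1) that inv_solve_left'[of "b \<otimes> inv g" g "g \<otimes> (b \<otimes> inv g)"]
    by (simp add: conj_map_def m_assoc)
  show ?thesis
    unfolding group_comm_def mult[OF xy(1,2)] mult[OF xy(2,1)] xy(3)
    using assms xy(1,2) by (simp add: conj_map_def)
qed

lemma trace_funs_conj_op:
  assumes "f \<in> trace_funs (group_comm G)" "g \<in> carrier G"
  shows "conj_op g f \<in> trace_funs (group_comm G)"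
proof (rule trace_funsI)
  show "conj_op g f (a @ [x, y] @ b) = conj_op g f (a @ [y, x] @ b)" if "group_comm G x y" for a b x y
    using trace_funs_swap[OF assms(1) conj_map_group_comm[OF assms(2) that]] by (simp add: conj_op_def)
  show "\<not> conj_op g f (a @ [x, x] @ b)" for a b x
    using trace_funs_square[OF assms(1)] by (simp add: conj_op_def)
qed

lemma conj_op_letter_op:
  "conj_op g (letter_op (conj_map g v) f) = letter_op v (conj_op g f)"
  by (simp add: fun_eq_iff conj_op_def letter_op_def)

text \<open>Precomposition reverses products. This is harmless for cactus relations: their
  generators are involutions, so a reversed relation is the inverse of the original one.\<close>

lemma conj_op_mult:
  "g \<in> carrier G \<Longrightarrow> h \<in> carrier G \<Longrightarrow> conj_op g (conj_op h f) = conj_op (h \<otimes> g) f"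
  by (simp add: fun_eq_iff conj_op_def conj_map_mult comp_def)

lemma conj_op_one: "conj_op \<one> f = f"
  by (simp add: fun_eq_iff conj_op_def conj_map_one)

end

section \<open>Presented groups\<close>

abbreviation word_class ::
    "'a set \<Rightarrow> ('a group_word \<times> 'a group_word) set \<Rightarrow> 'a group_word \<Rightarrow> 'a group_word set" where
  "word_class S R u \<equiv> word_cong S R `` {u}"

lemma word_class_eq_iff:
  "u \<in> words_over S \<Longrightarrow> v \<in> words_over S \<Longrightarrow>
    word_class S R u = word_class S R v \<longleftrightarrow> (u, v) \<in> word_cong S R"
  by (rule eq_equiv_class_iff[OF equiv_word_cong])

lemma carrier_presented_group: "carrier (presented_group S R) = word_class S R ` words_over S"
  by (auto simp: presented_group_def quotient_def)

lemma word_class_closed: "u \<in> words_over S \<Longrightarrow> word_class S R u \<in> carrier (presented_group S R)"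
  unfolding carrier_presented_group by (rule imageI)

lemma one_presented_group: "\<one>\<^bsub>presented_group S R\<^esub> = word_class S R []"
  by (simp add: presented_group_def)

lemma word_class_replicate:
  assumes "u \<in> words_over S"
  shows "word_class S R (concat (replicate m u)) = word_class S R u [^]\<^bsub>presented_group S R\<^esub> (m::nat)"
proof -
  interpret group "presented_group S R" by (rule group_presented_group)
  show ?thesis
  proof (induction m)
    case 0
    then show ?case by (simp add: one_presented_group)
  next
    case (Suc m)
    have "concat (replicate m u) \<in> words_over S" using assms by (auto simp: in_lists_conv_set)
    then show ?case
      using Suc presented_group_mult_class[OF assms, of "concat (replicate m u)" R]
        nat_pow_Suc2[OF word_class_closed[OF assms], of m]
      by simp
  qed
qed

text \<open>Relations not written over the generators are discarded by \<open>word_cong\<close>, so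
  enlarging the generating set only adds relations. For \<open>long_gens\<close> this gives the
  homomorphism splitting the surjection that kills the shortest generators.\<close>

lemma word_cong_mono:
  "(u, v) \<in> word_cong S R \<Longrightarrow> S \<subseteq> T \<Longrightarrow> (u, v) \<in> word_cong T R"
proof (induction rule: word_cong.induct)
  case (rel u v)
  then show ?case by (intro word_cong.rel) (auto simp: in_lists_conv_set)
next
  case (refl u)
  then show ?case by (intro word_cong.refl) (auto simp: in_lists_conv_set)
qed (blast intro: word_cong.intros)+

section \<open>The filtration by interval length\<close>

definition long_gens :: "nat \<Rightarrow> nat \<Rightarrow> (nat \<times> nat) set" where
  "long_gens n l = {(p, q) \<in> cactus_gens n. l \<le> q - p}"

text \<open>By the side conditions of \<open>word_cong\<close>, only those relations of
  \<open>cactus_rels n\<close> whose words lie over \<open>long_gens n l\<close> take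
  effect.\<close>

definition long_group :: "nat \<Rightarrow> nat \<Rightarrow> (nat \<times> nat) group_word set monoid" where
  "long_group n l = presented_group (long_gens n l) (cactus_rels n)"

lemma long_gens_Suc_subset: "long_gens n (Suc l) \<subseteq> long_gens n l"
  by (auto simp: long_gens_def)

lemma cactus_rels_cases:
  assumes "(u, v) \<in> cactus_rels n"
  obtains (square) p q where "(p, q) \<in> cactus_gens n" "u = [((p, q), True), ((p, q), True)]" "v = []"
  | (disjoint) p q m r where "(p, q) \<in> cactus_gens n" "(m, r) \<in> cactus_gens n"
      "{p..q} \<inter> {m..r} = {}" "u = [((p, q), True), ((m, r), True)]" "v = [((m, r), True), ((p, q), True)]"
  | (nested) p q m r where "(p, q) \<in> cactus_gens n" "(m, r) \<in> cactus_gens n"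
      "p \<le> m" "m < r" "r \<le> q" "u = [((p, q), True), ((m, r), True)]"
      "v = [((p + q - r, p + q - m), True), ((p, q), True)]"
  using assms unfolding cactus_rels_def Un_iff
proof (elim disjE)
  assume "(u, v) \<in> {(gen_word (p, q) @ gen_word (p, q), []) | p q. (p, q) \<in> cactus_gens n}"
  then show thesis using square by auto
next
  assume "(u, v) \<in> {(gen_word (p, q) @ gen_word (m, r), gen_word (m, r) @ gen_word (p, q)) | p q m r.
    (p, q) \<in> cactus_gens n \<and> (m, r) \<in> cactus_gens n \<and> {p..q} \<inter> {m..r} = {}}"
  then obtain p q m r where *: "(p, q) \<in> cactus_gens n" "(m, r) \<in> cactus_gens n"
    "{p..q} \<inter> {m..r} = {}" "u = gen_word (p, q) @ gen_word (m, r)" "v = gen_word (m, r) @ gen_word (p, q)"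
    by blast
  show thesis by (rule disjoint[OF *(1-3)]) (simp_all only: * append.simps)
next
  assume "(u, v) \<in> {(gen_word (p, q) @ gen_word (m, r),
      gen_word (p + q - r, p + q - m) @ gen_word (p, q)) | p q m r.
    (p, q) \<in> cactus_gens n \<and> (m, r) \<in> cactus_gens n \<and> {m..r} \<subseteq> {p..q}}"
  then obtain p q m r where *: "(p, q) \<in> cactus_gens n" "(m, r) \<in> cactus_gens n"
    "{m..r} \<subseteq> {p..q}" "u = gen_word (p, q) @ gen_word (m, r)"
    "v = gen_word (p + q - r, p + q - m) @ gen_word (p, q)"
    by blast
  have "p \<le> m" "m < r" "r \<le> q" using * by (auto simp: cactus_gens_def)
  from nested[OF *(1,2) this] show thesis by (simp only: * append.simps)
qed

section \<open>Killing the shortest generators\<close>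

abbreviation long_letters :: "nat \<Rightarrow> (nat \<times> nat) group_word \<Rightarrow> (nat \<times> nat) group_word" where
  "long_letters l \<equiv> filter (\<lambda>((p, q), b). l < q - p)"

lemma long_letters_words: "w \<in> words_over (long_gens n l) \<Longrightarrow> long_letters l w \<in> words_over (long_gens n (Suc l))"
  by (auto simp: in_lists_conv_set long_gens_def)

text \<open>Each relation either survives unchanged or becomes an equality of words. For nested
  intervals this holds because reflection preserves length, and because an outer interval of the
  shortest length equals the inner one.\<close>

lemma word_cong_long_letters:
  assumes "(u, v) \<in> word_cong (long_gens n l) (cactus_rels n)"
  shows "(long_letters l u, long_letters l v) \<in> word_cong (long_gens n (Suc l)) (cactus_rels n)"
  using assms
proof (induction rule: word_cong.induct)
  case (refl u)
  then show ?case by (intro word_cong.refl long_letters_words)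
next
  case (cancel s b)
  then show ?case
    by (cases s) (auto simp: long_gens_def intro!: word_cong.cancel word_cong.refl)
next
  case (rel u v)
  note W = long_letters_words[OF rel(2)] long_letters_words[OF rel(3)]
  have "long_letters l u = u \<and> long_letters l v = v \<or> long_letters l u = long_letters l v"
    using rel(1) by (cases rule: cactus_rels_cases) auto
  then show ?case
  proof (elim disjE)
    assume "long_letters l u = u \<and> long_letters l v = v"
    then show ?thesis using W rel(1) by (auto intro!: word_cong.rel)
  next
    assume "long_letters l u = long_letters l v"
    then show ?thesis using W by (auto intro!: word_cong.refl)
  qed
next
  case (append u v u' v')
  then show ?case by (simp add: word_cong.append)
qed (blast intro: word_cong.intros)+

section \<open>The action of one layer on trace functions\<close>

locale cactus_layer =
  fixes n l :: nat
begin

abbreviation "S \<equiv> long_gens n l"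
abbreviation "G \<equiv> long_group n l"
abbreviation "cls \<equiv> word_class S (cactus_rels n)"
abbreviation "F \<equiv> trace_funs (group_comm G)"

definition gen :: "nat \<times> nat \<Rightarrow> (nat \<times> nat) group_word set" where
  "gen s = cls [(s, True)]"

sublocale group G
  unfolding long_group_def by (rule group_presented_group)

text \<open>Words here have elements of \<open>G\<close> as letters. A shortest generator acts by
  its transvection; a longer one conjugates all letters, as it does on the kernel.\<close>

definition gen_op :: "nat \<times> nat \<Rightarrow> ((nat \<times> nat) group_word set list \<Rightarrow> bool) \<Rightarrow>
    (nat \<times> nat) group_word set list \<Rightarrow> bool" where
  "gen_op s f = (if snd s - fst s = l then letter_op (gen s) f else conj_op (gen s) f)"

text \<open>The exponent of a letter is ignored, since a generator and its inverse have the same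
  class and act by the same involution.\<close>

primrec word_op :: "(nat \<times> nat) group_word \<Rightarrow> ((nat \<times> nat) group_word set list \<Rightarrow> bool) \<Rightarrow>
    (nat \<times> nat) group_word set list \<Rightarrow> bool" where
  "word_op [] f = f"
| "word_op (x # w) f = gen_op (fst x) (word_op w f)"

lemma cls_closed: "w \<in> words_over S \<Longrightarrow> cls w \<in> carrier G"
  unfolding long_group_def by (rule word_class_closed)

lemma cls_append: "u \<in> words_over S \<Longrightarrow> v \<in> words_over S \<Longrightarrow> cls (u @ v) = cls u \<otimes>\<^bsub>G\<^esub> cls v"
  unfolding long_group_def by (simp add: presented_group_mult_class)

lemma cls_Nil: "cls [] = \<one>\<^bsub>G\<^esub>"
  by (simp add: long_group_def one_presented_group)

lemma gen_closed: "s \<in> S \<Longrightarrow> gen s \<in> carrier G"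
  unfolding gen_def by (rule cls_closed) simp

lemma cls_rel:
  assumes "(u, v) \<in> cactus_rels n" "u \<in> words_over S" "v \<in> words_over S"
  shows "cls u = cls v"
  using assms word_class_eq_iff word_cong.rel by blast

lemma cls_pair: "s \<in> S \<Longrightarrow> t \<in> S \<Longrightarrow> cls [(s, True), (t, True)] = gen s \<otimes>\<^bsub>G\<^esub> gen t"
  using cls_append[of "[(s, True)]" "[(t, True)]"] by (simp add: gen_def)

lemma gen_square: "s \<in> S \<Longrightarrow> gen s \<otimes>\<^bsub>G\<^esub> gen s = \<one>\<^bsub>G\<^esub>"
  using cls_rel[of "[(s, True), (s, True)]" "[]"]
  by (cases s) (auto simp: cls_pair[symmetric] cls_Nil[symmetric] cactus_rels_def long_gens_def)

lemma inv_gen: "s \<in> S \<Longrightarrow> inv\<^bsub>G\<^esub> gen s = gen s"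
  using gen_square gen_closed by (intro inv_equality) auto

lemma cls_letter:
  assumes "s \<in> S" shows "cls [(s, b)] = gen s"
proof (cases b)
  case False
  have "cls ([(s, False)] @ [(s, True)]) = cls []"
    using word_cong.cancel[OF assms, of False "cactus_rels n"] assms
    by (subst word_class_eq_iff) auto
  then have "cls [(s, False)] \<otimes>\<^bsub>G\<^esub> gen s = \<one>\<^bsub>G\<^esub>"
    using cls_append[of "[(s, False)]" "[(s, True)]"] assms by (simp add: gen_def cls_Nil)
  then have "inv\<^bsub>G\<^esub> gen s = cls [(s, False)]"
    by (rule inv_equality) (use assms in \<open>auto intro: gen_closed cls_closed\<close>)
  then show ?thesis using False inv_gen[OF assms] by simp
qed (simp add: gen_def)

lemma cls_Cons: "s \<in> S \<Longrightarrow> w \<in> words_over S \<Longrightarrow> cls ((s, b) # w) = gen s \<otimes>\<^bsub>G\<^esub> cls w"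
  using cls_append[of "[(s, b)]" w] by (simp add: cls_letter)

lemma gen_op_closed: "f \<in> F \<Longrightarrow> s \<in> S \<Longrightarrow> gen_op s f \<in> F"
  by (simp add: gen_op_def trace_funs_letter_op trace_funs_conj_op gen_closed)

lemma word_op_closed: "f \<in> F \<Longrightarrow> w \<in> words_over S \<Longrightarrow> word_op w f \<in> F"
  by (induction w) (auto intro: gen_op_closed)

lemma word_op_append: "word_op (u @ v) f = word_op u (word_op v f)"
  by (induction u) simp_all

lemma gen_op_involution: "f \<in> F \<Longrightarrow> s \<in> S \<Longrightarrow> gen_op s (gen_op s f) = f"
  by (simp add: gen_op_def letter_op_involution conj_op_mult gen_closed gen_square conj_op_one)

text \<open>If \<open>t\<close> is long too, all operators are conjugations, and their reversed
  order calls for the equation \<open>gen t \<otimes> gen s = gen s \<otimes> gen t'\<close>. If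
  \<open>t\<close> is shortest, it suffices that \<open>gen s\<close> conjugates
  \<open>gen t'\<close> to \<open>gen t\<close>.\<close>

lemma gen_op_intertwine:
  assumes S: "s \<in> S" "t \<in> S" "t' \<in> S" and long: "snd s - fst s \<noteq> l"
    and len: "snd t' - fst t' = snd t - fst t"
    and rel: "gen s \<otimes>\<^bsub>G\<^esub> gen t = gen t' \<otimes>\<^bsub>G\<^esub> gen s"
  shows "gen_op s (gen_op t f) = gen_op t' (gen_op s f)"
proof -
  note c = gen_closed[OF S(1)] gen_closed[OF S(2)] gen_closed[OF S(3)]
  have t: "gen s \<otimes>\<^bsub>G\<^esub> (gen t' \<otimes>\<^bsub>G\<^esub> gen s) = gen t"
    using c gen_square[OF S(1)] by (simp add: rel[symmetric] m_assoc[symmetric])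
  have "gen t \<otimes>\<^bsub>G\<^esub> gen s = gen s \<otimes>\<^bsub>G\<^esub> gen t'"
    using c gen_square[OF S(1)] by (simp add: t[symmetric] m_assoc)
  moreover have "conj_map (gen s) (gen t') = gen t"
    using c t by (simp add: conj_map_def inv_gen[OF S(1)] m_assoc)
  ultimately show ?thesis
    using long len c conj_op_letter_op[of "gen s" "gen t'" f]
    by (auto simp: gen_op_def conj_op_mult)
qed

text \<open>Only the defining relations need thought. Those with a longer outer or disjoint
  generator follow from \<open>gen_op_intertwine\<close>; two disjoint shortest generators act by
  transvections of commuting letters.\<close>

lemma word_op_cong:
  assumes "(u, v) \<in> word_cong S (cactus_rels n)" "f \<in> F"
  shows "word_op u f = word_op v f"
  using assms
proof (induction arbitrary: f rule: word_cong.induct)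
  case (append u v u' v')
  then show ?case
    using word_op_closed word_cong_words by (metis word_op_append)
next
  case (cancel s b)
  then show ?case by (simp add: gen_op_involution)
next
  case (rel u v)
  from rel(1) show ?case
  proof (cases rule: cactus_rels_cases)
    case (square p q)
    then show ?thesis using rel by (simp add: gen_op_involution)
  next
    case (disjoint p q m r)
    then have S: "(p, q) \<in> S" "(m, r) \<in> S" using rel by auto
    have comm: "gen (p, q) \<otimes>\<^bsub>G\<^esub> gen (m, r) = gen (m, r) \<otimes>\<^bsub>G\<^esub> gen (p, q)"
      using cls_rel[OF rel(1-3)] S unfolding disjoint(4,5) by (simp add: cls_pair)
    consider "q - p \<noteq> l" | "r - m \<noteq> l" | "q - p = l" "r - m = l" by blast
    then have "gen_op (p, q) (gen_op (m, r) f) = gen_op (m, r) (gen_op (p, q) f)"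
    proof cases
      case 1
      then show ?thesis using S comm by (intro gen_op_intertwine) auto
    next
      case 2
      then show ?thesis using S comm by (intro gen_op_intertwine[symmetric]) auto
    next
      case 3
      have "group_comm G (gen (p, q)) (gen (m, r))"
        using S comm by (simp add: group_comm_def gen_closed)
      then show ?thesis using 3 letter_op_commute[OF rel(4)] by (simp add: gen_op_def)
    qed
    then show ?thesis by (simp add: disjoint)
  next
    case (nested p q m r)
    then have S: "(p, q) \<in> S" "(m, r) \<in> S" "(p + q - r, p + q - m) \<in> S" using rel by auto
    have c: "gen (p, q) \<otimes>\<^bsub>G\<^esub> gen (m, r) = gen (p + q - r, p + q - m) \<otimes>\<^bsub>G\<^esub> gen (p, q)"
      using cls_rel[OF rel(1-3)] S unfolding nested(6,7) by (simp add: cls_pair)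
    show ?thesis
    proof (cases "q - p = l")
      case True
      \<comment> \<open>No interval of length at least \<open>l\<close> lies properly inside a
        shortest one, so the relation is trivial.\<close>
      then have "m = p" "r = q" using S(2) nested by (auto simp: long_gens_def)
      then show ?thesis by (simp add: nested)
    next
      case False
      have "gen_op (p, q) (gen_op (m, r) f) = gen_op (p + q - r, p + q - m) (gen_op (p, q) f)"
        by (rule gen_op_intertwine[OF S]) (use nested False c in auto)
      then show ?thesis by (simp add: nested)
    qed
  qed
qed auto

section \<open>Transvections and the kernel\<close>

text \<open>The definition via the action makes faithfulness immediate; this set contains all conjugates of
  the shortest generators by words in the longer ones.\<close>

definition transvections :: "(nat \<times> nat) group_word set set" where
  "transvections = {v. v \<otimes>\<^bsub>G\<^esub> v = \<one>\<^bsub>G\<^esub> \<and>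
     (\<exists>w\<in>words_over S. v = cls w \<and> (\<forall>f\<in>F. word_op w f = letter_op v f))}"

lemma transvections_subset: "transvections \<subseteq> carrier G"
  by (auto simp: transvections_def intro: cls_closed)

lemma gen_transvection:
  assumes "s \<in> S" "snd s - fst s = l" shows "gen s \<in> transvections"
proof -
  have "gen_word s \<in> words_over S" using assms by simp
  moreover have "word_op (gen_word s) f = letter_op (gen s) f" for f
    using assms(2) by (simp add: gen_op_def)
  ultimately show ?thesis
    unfolding transvections_def using gen_square[OF assms(1)] gen_def[of s] by blast
qed

text \<open>The operator of a longer generator conjugates the transvection of \<open>v\<close> to
  that of the conjugate letter, so \<open>s w s\<close> is a witness whenever \<open>w\<close> is
  one for \<open>v\<close>.\<close>

lemma conj_transvection:
  assumes "s \<in> S" "snd s - fst s \<noteq> l" "v \<in> transvections"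
  shows "gen s \<otimes>\<^bsub>G\<^esub> v \<otimes>\<^bsub>G\<^esub> gen s \<in> transvections"
proof -
  let ?v = "gen s \<otimes>\<^bsub>G\<^esub> v \<otimes>\<^bsub>G\<^esub> gen s"
  obtain w where w: "w \<in> words_over S" "v = cls w" "v \<otimes>\<^bsub>G\<^esub> v = \<one>\<^bsub>G\<^esub>"
    "\<And>f. f \<in> F \<Longrightarrow> word_op w f = letter_op v f"
    using assms(3) by (auto simp: transvections_def)
  have c: "v \<in> carrier G" "gen s \<in> carrier G" using w(1,2) cls_closed gen_closed[OF assms(1)] by auto
  let ?w = "(s, True) # w @ [(s, True)]"
  have cls: "cls ?w = ?v"
    using assms(1) w(1,2) c cls_append[of w "[(s, True)]"]
    by (simp add: cls_Cons[where w = "w @ [(s, True)]"] gen_def[symmetric] m_assoc)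
  have sq: "gen s \<otimes>\<^bsub>G\<^esub> (gen s \<otimes>\<^bsub>G\<^esub> x) = x" if "x \<in> carrier G" for x
    using that c gen_square[OF assms(1)] by (simp add: m_assoc[symmetric])
  have sq': "v \<otimes>\<^bsub>G\<^esub> (v \<otimes>\<^bsub>G\<^esub> x) = x" if "x \<in> carrier G" for x
    using that c w(3) by (simp add: m_assoc[symmetric])
  have inv: "?v \<otimes>\<^bsub>G\<^esub> ?v = \<one>\<^bsub>G\<^esub>"
    using c by (simp add: m_assoc sq sq' gen_square[OF assms(1)])
  have v: "conj_map (gen s) ?v = v"
    using c by (simp add: conj_map_def inv_gen[OF assms(1)] m_assoc sq gen_square[OF assms(1)])
  have "word_op ?w f = letter_op ?v f" if f: "f \<in> F" for f
  proof -
    have f': "gen_op s f \<in> F" by (rule gen_op_closed[OF f assms(1)])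
    have "word_op ?w f = conj_op (gen s) (letter_op v (conj_op (gen s) f))"
      using w(4)[OF f'] assms(2) by (simp add: word_op_append gen_op_def)
    also have "\<dots> = letter_op ?v (conj_op (gen s) (conj_op (gen s) f))"
      using conj_op_letter_op[of "gen s" ?v] by (simp add: v)
    also have "\<dots> = letter_op ?v f"
      using c by (simp add: conj_op_mult gen_square[OF assms(1)] conj_op_one)
    finally show ?thesis .
  qed
  moreover have "?w \<in> words_over S" using w(1) assms(1) by simp
  ultimately show ?thesis
    unfolding transvections_def using inv cls by blast
qed

text \<open>Concatenating the witnessing words of the letters gives a word that acts as
  \<open>list_op vs\<close> and represents the product. If the product is trivial, this word is
  congruent to the empty one and acts as the identity.\<close>

lemma transvections_act_faithfully:
  assumes "vs \<in> lists transvections" "group_prod G vs = \<one>\<^bsub>G\<^esub>" "f \<in> F"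
  shows "list_op vs f = f"
proof -
  have "\<exists>w\<in>words_over S. cls w = group_prod G vs \<and> (\<forall>f\<in>F. word_op w f = list_op vs f)"
    using assms(1)
  proof (induction vs rule: list.induct)
    case Nil
    show ?case by (rule bexI[of _ "[]"]) (simp_all only: cls_Nil group_prod_Nil, simp_all)
  next
    case (Cons v vs)
    have v: "v \<in> transvections" and vs: "vs \<in> lists transvections" using Cons.prems by simp_all
    from Cons.IH[OF vs] obtain w where w: "w \<in> words_over S" "cls w = group_prod G vs"
      "\<And>f. f \<in> F \<Longrightarrow> word_op w f = list_op vs f" by blast
    obtain w' where w': "w' \<in> words_over S" "v = cls w'"
      "\<And>f. f \<in> F \<Longrightarrow> word_op w' f = letter_op v f"
      using v unfolding transvections_def by blast
    show ?case
    proof (intro bexI[of _ "w' @ w"] conjI ballI)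
      show "cls (w' @ w) = group_prod G (v # vs)"
        using w(2) w'(2) by (simp add: cls_append[OF w'(1) w(1)] group_prod_Cons)
      show "word_op (w' @ w) f = list_op (v # vs) f" if "f \<in> F" for f
        using w(3)[OF that] w'(3)[OF trace_funs_list_op[OF that]] by (simp add: word_op_append)
      show "w' @ w \<in> words_over S" using w(1) w'(1) by simp
    qed
  qed
  then obtain w where w: "w \<in> words_over S" "cls w = group_prod G vs"
    "\<forall>f\<in>F. word_op w f = list_op vs f" by blast
  then have "cls w = cls []" by (simp only: assms(2) cls_Nil)
  then have "(w, []) \<in> word_cong S (cactus_rels n)"
    using w(1) by (subst (asm) word_class_eq_iff) auto
  from word_op_cong[OF this assms(3)] w(3) assms(3) show ?thesis by simp
qed

text \<open>Moving \<open>gen s\<close> to the right replaces each factor by its conjugate, which is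
  again a transvection.\<close>

lemma conj_group_prod:
  assumes s: "s \<in> S" "snd s - fst s \<noteq> l" and "vs \<in> lists transvections"
  shows "\<exists>us\<in>lists transvections. gen s \<otimes>\<^bsub>G\<^esub> group_prod G vs = group_prod G us \<otimes>\<^bsub>G\<^esub> gen s"
  using assms(3)
proof (induction vs rule: list.induct)
  case Nil
  then show ?case using gen_closed[OF s(1)] by (auto intro!: bexI[of _ "[]"] simp: group_prod_Nil)
next
  case (Cons v vs)
  then obtain us where us: "us \<in> lists transvections"
    "gen s \<otimes>\<^bsub>G\<^esub> group_prod G vs = group_prod G us \<otimes>\<^bsub>G\<^esub> gen s" by auto
  let ?v = "gen s \<otimes>\<^bsub>G\<^esub> v \<otimes>\<^bsub>G\<^esub> gen s"
  have VC: "xs \<in> lists (carrier G)" if "xs \<in> lists transvections" for xs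
    using that transvections_subset by blast
  have c: "gen s \<in> carrier G" "v \<in> carrier G" "group_prod G vs \<in> carrier G" "group_prod G us \<in> carrier G"
    using gen_closed[OF s(1)] Cons.prems us(1) transvections_subset group_prod_closed[OF VC]
    by auto
  have "group_prod G (?v # us) \<otimes>\<^bsub>G\<^esub> gen s = ?v \<otimes>\<^bsub>G\<^esub> (group_prod G us \<otimes>\<^bsub>G\<^esub> gen s)"
    using c by (simp add: group_prod_Cons m_assoc)
  also have "\<dots> = gen s \<otimes>\<^bsub>G\<^esub> v \<otimes>\<^bsub>G\<^esub> (gen s \<otimes>\<^bsub>G\<^esub> gen s) \<otimes>\<^bsub>G\<^esub> group_prod G vs"
    using c by (simp add: us(2)[symmetric] m_assoc)
  also have "\<dots> = gen s \<otimes>\<^bsub>G\<^esub> group_prod G (v # vs)"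
    using c by (simp add: gen_square[OF s(1)] group_prod_Cons m_assoc)
  finally have "gen s \<otimes>\<^bsub>G\<^esub> group_prod G (v # vs) = group_prod G (?v # us) \<otimes>\<^bsub>G\<^esub> gen s" ..
  moreover have "?v # us \<in> lists transvections"
    using us(1) conj_transvection[OF s] Cons.prems by simp
  ultimately show ?case by blast
qed

text \<open>Building the word up from its right end, a shortest letter joins the product of
  transvections, while a longer one is moved through it by \<open>conj_group_prod\<close> and joins
  the second factor.\<close>

lemma cls_decomposition:
  assumes "w \<in> words_over S"
  shows "\<exists>vs\<in>lists transvections. cls w = group_prod G vs \<otimes>\<^bsub>G\<^esub> cls (long_letters l w)"
  using assms
proof (induction w rule: list.induct)
  case Nil
  have "cls [] = group_prod G [] \<otimes>\<^bsub>G\<^esub> cls (long_letters l [])"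
    by (simp add: cls_Nil group_prod_Nil del: Image_singleton_iff)
  then show ?case by blast
next
  case (Cons x w)
  obtain s b where x: "x = (s, b)" by (cases x)
  have s: "s \<in> S" and w: "w \<in> words_over S" using Cons.prems x by auto
  have lw: "long_letters l w \<in> words_over S" using w by (auto simp: in_lists_conv_set)
  obtain vs where vs: "vs \<in> lists transvections"
    "cls w = group_prod G vs \<otimes>\<^bsub>G\<^esub> cls (long_letters l w)" using Cons.IH w by auto
  have VC: "group_prod G us \<in> carrier G" if "us \<in> lists transvections" for us
    using that transvections_subset group_prod_closed by blast
  note c = gen_closed[OF s] VC[OF vs(1)] cls_closed[OF lw]
  have eq: "cls (x # w) = gen s \<otimes>\<^bsub>G\<^esub> group_prod G vs \<otimes>\<^bsub>G\<^esub> cls (long_letters l w)"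
    using c by (simp add: x cls_Cons[OF s w] vs(2) m_assoc)
  show ?case
  proof (cases "snd s - fst s = l")
    case True
    then have "long_letters l (x # w) = long_letters l w" by (cases s) (simp add: x)
    then have "cls (x # w) = group_prod G (gen s # vs) \<otimes>\<^bsub>G\<^esub> cls (long_letters l (x # w))"
      using eq by (simp add: group_prod_Cons)
    moreover have "gen s # vs \<in> lists transvections" using gen_transvection[OF s True] vs(1) by simp
    ultimately show ?thesis by blast
  next
    case False
    then have "long_letters l (x # w) = x # long_letters l w"
      using s by (cases s) (auto simp: x long_gens_def)
    then have long: "cls (long_letters l (x # w)) = gen s \<otimes>\<^bsub>G\<^esub> cls (long_letters l w)"
      by (simp add: x cls_Cons[OF s lw])
    obtain us where us: "us \<in> lists transvections"
      "gen s \<otimes>\<^bsub>G\<^esub> group_prod G vs = group_prod G us \<otimes>\<^bsub>G\<^esub> gen s"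
      using conj_group_prod[OF s False vs(1)] by blast
    have "cls (x # w) = group_prod G us \<otimes>\<^bsub>G\<^esub> cls (long_letters l (x # w))"
      unfolding eq us(2) long using c VC[OF us(1)] by (simp add: m_assoc)
    then show ?thesis using us(1) by blast
  qed
qed

text \<open>An element of odd order has trivial image in the next group by assumption. The splitting
  makes the second factor of its decomposition trivial in \<open>G\<close>, leaving a product of
  transvections.\<close>

lemma no_odd_torsion_step:
  assumes "no_odd_torsion (long_group n (Suc l))"
  shows "no_odd_torsion G"
  unfolding no_odd_torsion_def
proof (intro ballI allI impI)
  fix x and m :: nat
  assume x: "x \<in> carrier G" and m: "odd m" and pow: "x [^]\<^bsub>G\<^esub> m = \<one>\<^bsub>G\<^esub>"
  let ?S = "long_gens n (Suc l)" and ?R = "cactus_rels n"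
  let ?H = "long_group n (Suc l)"
  obtain w where w: "w \<in> words_over S" "x = cls w"
    using x by (auto simp: long_group_def carrier_presented_group)
  let ?u = "long_letters l w"
  have u: "?u \<in> words_over ?S" by (rule long_letters_words[OF w(1)])
  have u': "?u \<in> words_over S" using w(1) by (auto simp: in_lists_conv_set)
  have wm: "concat (replicate m w) \<in> words_over S" and um: "concat (replicate m ?u) \<in> words_over ?S"
    using w(1) u by (auto simp: in_lists_conv_set)
  have "cls (concat (replicate m w)) = cls []"
    using pow w word_class_replicate[OF w(1), of ?R m]
    by (simp add: long_group_def one_presented_group)
  then have "(concat (replicate m w), []) \<in> word_cong S ?R"
    using wm by (subst (asm) word_class_eq_iff) auto
  from word_cong_long_letters[OF this]
  have "(concat (replicate m ?u), []) \<in> word_cong ?S ?R"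
    by (simp add: filter_concat)
  then have "word_class ?S ?R (concat (replicate m ?u)) = word_class ?S ?R []"
    using um by (subst word_class_eq_iff) auto
  then have "word_class ?S ?R ?u [^]\<^bsub>?H\<^esub> m = \<one>\<^bsub>?H\<^esub>"
    using word_class_replicate[OF u, of ?R m] by (simp add: long_group_def one_presented_group)
  then have "word_class ?S ?R ?u = word_class ?S ?R []"
    using assms m word_class_closed[OF u, of ?R]
    by (simp add: no_odd_torsion_def long_group_def one_presented_group)
  then have "(?u, []) \<in> word_cong ?S ?R" using u by (subst (asm) word_class_eq_iff) auto
  then have "(?u, []) \<in> word_cong S ?R" using word_cong_mono long_gens_Suc_subset by blast
  then have one: "cls ?u = \<one>\<^bsub>G\<^esub>" unfolding cls_Nil[symmetric] using u' by (subst word_class_eq_iff) auto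
  obtain vs where vs: "vs \<in> lists transvections" "x = group_prod G vs \<otimes>\<^bsub>G\<^esub> cls ?u"
    using cls_decomposition[OF w(1)] w(2) by blast
  have "vs \<in> lists (carrier G)" using vs(1) transvections_subset by blast
  then have xvs: "x = group_prod G vs" using vs(2) one group_prod_closed by simp
  have "group_prod G vs = \<one>\<^bsub>G\<^esub>"
  proof (rule odd_torsion_trivial_if_list_op_faithful[OF transvections_subset _ _ m vs(1)])
    show "v \<otimes>\<^bsub>G\<^esub> v = \<one>\<^bsub>G\<^esub>" if "v \<in> transvections" for v
      using that by (simp add: transvections_def)
    show "list_op us f = f" if "us \<in> lists transvections" "group_prod G us = \<one>\<^bsub>G\<^esub>" "f \<in> F" for us f
      by (rule transvections_act_faithfully[OF that])
    show "group_prod G vs [^]\<^bsub>G\<^esub> m = \<one>\<^bsub>G\<^esub>" using pow xvs by simp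
  qed
  then show "x = \<one>\<^bsub>G\<^esub>" using xvs by simp
qed

end

lemma long_gens_top: "long_gens n n = {}"
  by (auto simp: long_gens_def cactus_gens_def)

text \<open>Downward induction from \<open>l = n\<close>, where the group is trivial because every
  difference \<open>q - p\<close> is less than \<open>n\<close>.\<close>

lemma no_odd_torsion_long_group: "l \<le> n \<Longrightarrow> no_odd_torsion (long_group n l)"
proof (induction l rule: inc_induct)
  case base
  show ?case
    by (simp add: no_odd_torsion_def long_group_def long_gens_top carrier_presented_group
        one_presented_group lists_empty)
next
  case (step l)
  then show ?case by (simp add: cactus_layer.no_odd_torsion_step)
qed

lemma cactus_group_eq_long_group: "cactus_group n = long_group n 0"
  by (simp add: cactus_group_def long_group_def long_gens_def)

lemma no_odd_torsion_cactus_group: "no_odd_torsion (cactus_group n)"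
  by (simp add: cactus_group_eq_long_group no_odd_torsion_long_group)

section \<open>Elements of order a power of two\<close>

lemma (in group) intertwine_pow:
  assumes "s \<in> carrier G" "x \<in> carrier G" "y \<in> carrier G" "s \<otimes> x = y \<otimes> s"
  shows "s \<otimes> x [^] (N::nat) = y [^] N \<otimes> s"
proof (induction N)
  case (Suc N)
  have "s \<otimes> x [^] Suc N = s \<otimes> x [^] N \<otimes> x" using assms by (simp add: m_assoc)
  also have "\<dots> = y [^] N \<otimes> (s \<otimes> x)" unfolding Suc using assms by (simp add: m_assoc)
  also have "\<dots> = y [^] Suc N \<otimes> s" unfolding assms(4) using assms(1-3) by (simp add: m_assoc)
  finally show ?case .
qed (use assms in simp)

text \<open>As in a wreath product with a group of order two, \<open>s\<close> conjugates
  \<open>x\<close> to \<open>y\<close>. Hence \<open>y [^] N\<close> is trivial as well, and the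
  square of \<open>s \<otimes> x\<close> is the commuting product
  \<open>y \<otimes> x\<close>.\<close>

lemma (in group) wreath_pow_eq_one:
  assumes "s \<in> carrier G" "x \<in> carrier G" "y \<in> carrier G"
    and "s \<otimes> s = \<one>" "s \<otimes> x = y \<otimes> s" "y \<otimes> x = x \<otimes> y" "x [^] (N::nat) = \<one>"
  shows "(s \<otimes> x) [^] (2 * N) = \<one>"
proof -
  have "s = y [^] N \<otimes> s" using intertwine_pow[OF assms(1-3,5), of N] assms by simp
  then have y: "y [^] N = \<one>" using assms by (metis nat_pow_closed r_cancel_one)
  have "(s \<otimes> x) [^] (2::nat) = y \<otimes> s \<otimes> (s \<otimes> x)"
    using assms by (simp add: numeral_2_eq_2)
  also have "\<dots> = y \<otimes> (s \<otimes> s) \<otimes> x"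
    using assms(1-3) by (simp add: m_assoc)
  finally have "(s \<otimes> x) [^] (2::nat) = y \<otimes> x" using assms by simp
  then have "(s \<otimes> x) [^] (2 * N) = (y \<otimes> x) [^] N"
    using assms by (metis m_closed nat_pow_pow)
  also have "\<dots> = \<one>" using assms y by (simp add: pow_mult_distrib)
  finally show ?thesis .
qed

lemma word_class_intertwine:
  fixes S R
  defines "G \<equiv> presented_group S R"
  assumes g: "g \<in> carrier G"
    and w: "w \<in> words_over S" "map \<phi> w \<in> words_over S"
    and rel: "\<And>a. a \<in> set w \<Longrightarrow> g \<otimes>\<^bsub>G\<^esub> word_class S R [a] = word_class S R [\<phi> a] \<otimes>\<^bsub>G\<^esub> g"
  shows "g \<otimes>\<^bsub>G\<^esub> word_class S R w = word_class S R (map \<phi> w) \<otimes>\<^bsub>G\<^esub> g"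
  using w rel
proof (induction w rule: list.induct)
  case Nil
  interpret group G unfolding G_def by (rule group_presented_group)
  have "word_class S R [] = \<one>\<^bsub>G\<^esub>" by (simp add: G_def one_presented_group)
  then show ?case using g by simp
next
  case (Cons a w)
  interpret group G unfolding G_def by (rule group_presented_group)
  let ?c = "word_class S R"
  have split: "?c (b # v) = ?c [b] \<otimes>\<^bsub>G\<^esub> ?c v" if "b # v \<in> words_over S" for b v
    using presented_group_mult_class[of "[b]" S v R] that by (auto simp: G_def)
  have closed: "?c v \<in> carrier G" if "v \<in> words_over S" for v
    unfolding G_def by (rule word_class_closed[OF that])
  have c: "?c [a] \<in> carrier G" "?c w \<in> carrier G" "?c [\<phi> a] \<in> carrier G" "?c (map \<phi> w) \<in> carrier G"
    using Cons.prems(1,2) by (simp_all add: closed)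
  have IH: "g \<otimes>\<^bsub>G\<^esub> ?c w = ?c (map \<phi> w) \<otimes>\<^bsub>G\<^esub> g" by (rule Cons.IH) (use Cons.prems in auto)
  have "g \<otimes>\<^bsub>G\<^esub> ?c (a # w) = g \<otimes>\<^bsub>G\<^esub> ?c [a] \<otimes>\<^bsub>G\<^esub> ?c w"
    using split[OF Cons.prems(1)] c g by (simp add: m_assoc)
  also have "\<dots> = ?c [\<phi> a] \<otimes>\<^bsub>G\<^esub> (g \<otimes>\<^bsub>G\<^esub> ?c w)"
    using Cons.prems(3)[of a] c g by (simp add: m_assoc)
  also have "\<dots> = ?c (map \<phi> (a # w)) \<otimes>\<^bsub>G\<^esub> g"
    using split[of "\<phi> a" "map \<phi> w"] Cons.prems(2) c g by (simp add: m_assoc IH)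
  finally show ?case .
qed

section \<open>Towers of nested generators: the upper bound on the order\<close>

primrec tower :: "nat \<Rightarrow> (nat \<times> nat) group_word" where
  "tower 0 = []"
| "tower (Suc k) = ((1, 2 ^ Suc k), True) # tower k"

lemma tower_letters: "a \<in> set (tower k) \<Longrightarrow> \<exists>i. 1 \<le> i \<and> i \<le> k \<and> a = ((1, 2 ^ i), True)"
  by (induction k) (auto intro: le_SucI)

lemma interval_gen: "1 \<le> i \<Longrightarrow> 2 ^ i \<le> n \<Longrightarrow> (1, 2 ^ i) \<in> cactus_gens n"
  using one_less_power[of "2::nat" i] by (simp add: cactus_gens_def)

lemma tower_words:
  assumes "2 ^ k \<le> n" shows "tower k \<in> words_over (cactus_gens n)"
proof -
  have "a \<in> cactus_gens n \<times> UNIV" if a: "a \<in> set (tower k)" for a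
  proof -
    obtain i where i: "1 \<le> i" "i \<le> k" "a = ((1, 2 ^ i), True)" using tower_letters[OF a] by blast
    have "(2::nat) ^ i \<le> 2 ^ k" using i(2) by simp
    with interval_gen[of i n] i assms show ?thesis by (simp del: One_nat_def)
  qed
  then show ?thesis by (auto simp: in_lists_conv_set)
qed

text \<open>\<open>wreath_pow_eq_one\<close> applies to the new longest generator, the previous
  tower and its mirror image \<open>map ?\<phi> (tower k)\<close>: the nested relations give the
  intertwining, the disjoint ones the commutation.\<close>

lemma tower_pow_eq_one:
  "2 ^ k \<le> n \<Longrightarrow>
    word_class (cactus_gens n) (cactus_rels n) (tower k) [^]\<^bsub>cactus_group n\<^esub> (2 ^ k :: nat)
      = \<one>\<^bsub>cactus_group n\<^esub>"
proof (induction k)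
  case 0
  interpret group "cactus_group n" by (rule group_cactus_group)
  have "word_class (cactus_gens n) (cactus_rels n) (tower 0) = \<one>\<^bsub>cactus_group n\<^esub>"
    by (simp add: cactus_group_def one_presented_group)
  then show ?case by simp
next
  case (Suc k)
  interpret group "cactus_group n" by (rule group_cactus_group)
  let ?G = "cactus_group n" and ?S = "cactus_gens n" and ?R = "cactus_rels n"
  let ?c = "word_class ?S ?R" and ?q = "2 ^ Suc k :: nat"
  let ?\<phi> = "\<lambda>((m, r), b). ((1 + ?q - r, 1 + ?q - m), b)" and ?s = "((1, ?q), True)"
  have s: "(1, ?q) \<in> ?S" using Suc.prems by (intro interval_gen) auto
  have closed: "?c v \<in> carrier ?G" if "v \<in> words_over ?S" for v
    unfolding cactus_group_def by (rule word_class_closed[OF that])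
  have mult: "?c u \<otimes>\<^bsub>?G\<^esub> ?c v = ?c (u @ v)" if "u \<in> words_over ?S" "v \<in> words_over ?S" for u v
    unfolding cactus_group_def by (rule presented_group_mult_class[OF that])
  have rel: "?c u = ?c v" if "(u, v) \<in> ?R" for u v
    using that cactus_rels_words[of n] by (subst word_class_eq_iff) (auto intro: word_cong.rel)
  have letters: "(1, 2 ^ i) \<in> ?S" "(1 + ?q - 2 ^ i, ?q) \<in> ?S" if "1 \<le> i" "i \<le> k" for i
  proof -
    define a where "a = (2::nat) ^ i"
    have "a \<le> 2 ^ k" "1 < a" using that one_less_power[of "2::nat" i] unfolding a_def by simp_all
    then show "(1, 2 ^ i) \<in> ?S" "(1 + ?q - 2 ^ i, ?q) \<in> ?S"
      using Suc.prems unfolding a_def[symmetric] cactus_gens_def by auto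
  qed
  have w: "tower k \<in> words_over ?S" using Suc.prems by (intro tower_words) simp
  have \<phi>: "\<exists>i. 1 \<le> i \<and> i \<le> k \<and> a = ((1 + ?q - 2 ^ i, ?q), True)" if "a \<in> set (map ?\<phi> (tower k))" for a
    using that by (auto dest!: tower_letters)
  have w': "map ?\<phi> (tower k) \<in> words_over ?S"
    unfolding in_lists_conv_set using \<phi> letters(2) by blast
  have "?c [?s] \<otimes>\<^bsub>?G\<^esub> ?c (tower k) = ?c (map ?\<phi> (tower k)) \<otimes>\<^bsub>?G\<^esub> ?c [?s]"
    unfolding cactus_group_def
  proof (rule word_class_intertwine[OF _ w w'], fold cactus_group_def)
    show "?c [?s] \<in> carrier ?G" using s by (intro closed) simp
    fix a assume "a \<in> set (tower k)"
    then obtain i where i: "1 \<le> i" "i \<le> k" "a = ((1, 2 ^ i), True)" using tower_letters by blast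
    have "(gen_word (1, ?q) @ gen_word (1, 2 ^ i), gen_word (1 + ?q - 2 ^ i, 1 + ?q - 1) @ gen_word (1, ?q)) \<in> ?R"
    proof -
      have "(2::nat) ^ i \<le> ?q" using i(2) by (intro power_increasing) auto
      then have "{1..2 ^ i} \<subseteq> {1..?q}" by auto
      with s letters(1)[OF i(1,2)] show ?thesis unfolding cactus_rels_def by blast
    qed
    from rel[OF this] show "?c [?s] \<otimes>\<^bsub>?G\<^esub> ?c [a] = ?c [?\<phi> a] \<otimes>\<^bsub>?G\<^esub> ?c [?s]"
      using s letters[OF i(1,2)] by (simp add: i(3) mult)
  qed
  moreover have "?c (map ?\<phi> (tower k)) \<otimes>\<^bsub>?G\<^esub> ?c (tower k) = ?c (tower k) \<otimes>\<^bsub>?G\<^esub> ?c (map ?\<phi> (tower k))"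
  proof -
    have pair: "?c [b] \<otimes>\<^bsub>?G\<^esub> ?c [a] = ?c [a] \<otimes>\<^bsub>?G\<^esub> ?c [b]"
      if ab: "a \<in> set (tower k)" "b \<in> set (map ?\<phi> (tower k))" for a b
    proof -
      obtain i where i: "1 \<le> i" "i \<le> k" "a = ((1, 2 ^ i), True)" using tower_letters ab(1) by blast
      obtain j where j: "1 \<le> j" "j \<le> k" "b = ((1 + ?q - 2 ^ j, ?q), True)" using \<phi>[OF ab(2)] by blast
      have "(2::nat) ^ i \<le> 2 ^ k" "(2::nat) ^ j \<le> 2 ^ k" using i(2) j(2) by simp_all
      \<comment> \<open>The tower uses intervals in the lower half of \<open>{1..?q}\<close>, its
        mirror image intervals in the upper half.\<close>
      then have "2 ^ i < 1 + ?q - 2 ^ j" unfolding power_Suc by linarith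
      then have "{1 + ?q - 2 ^ j..?q} \<inter> {1..2 ^ i} = {}" by auto
      then have "(gen_word (1 + ?q - 2 ^ j, ?q) @ gen_word (1, 2 ^ i),
          gen_word (1, 2 ^ i) @ gen_word (1 + ?q - 2 ^ j, ?q)) \<in> ?R"
        using letters(2)[OF j(1,2)] letters(1)[OF i(1,2)] unfolding cactus_rels_def by blast
      from rel[OF this] show ?thesis
        using letters(2)[OF j(1,2)] letters(1)[OF i(1,2)] by (simp add: i(3) j(3) mult)
    qed
    \<comment> \<open>With the identity as \<open>\<phi>\<close>, intertwining means commuting:
      first one mirror letter with the whole tower, then the tower with its whole mirror
      image.\<close>
    have letter: "?c [b] \<otimes>\<^bsub>?G\<^esub> ?c (tower k) = ?c (tower k) \<otimes>\<^bsub>?G\<^esub> ?c [b]"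
      if b: "b \<in> set (map ?\<phi> (tower k))" for b
      using word_class_intertwine[of "?c [b]" ?S ?R "tower k" "\<lambda>a. a"] pair[OF _ b] w w' b
        closed[of "[b]"] by (simp add: cactus_group_def[symmetric] in_lists_conv_set del: set_map)
    show ?thesis
      using word_class_intertwine[of "?c (tower k)" ?S ?R "map ?\<phi> (tower k)" "\<lambda>a. a"] letter w' closed[OF w]
      by (simp add: cactus_group_def[symmetric] del: set_map map_map)
  qed
  moreover have "?c [?s] \<otimes>\<^bsub>?G\<^esub> ?c [?s] = \<one>\<^bsub>?G\<^esub>"
  proof -
    have "(gen_word (1, ?q) @ gen_word (1, ?q), []) \<in> ?R" using s unfolding cactus_rels_def by blast
    from rel[OF this] have "?c [?s] \<otimes>\<^bsub>?G\<^esub> ?c [?s] = ?c []" using s by (simp add: mult)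
    then show ?thesis by (simp add: cactus_group_def one_presented_group)
  qed
  moreover have "?c (tower k) [^]\<^bsub>?G\<^esub> (2 ^ k :: nat) = \<one>\<^bsub>?G\<^esub>" using Suc by simp
  ultimately have "(?c [?s] \<otimes>\<^bsub>?G\<^esub> ?c (tower k)) [^]\<^bsub>?G\<^esub> (2 * 2 ^ k :: nat) = \<one>\<^bsub>?G\<^esub>"
    using wreath_pow_eq_one[of "?c [?s]" "?c (tower k)" "?c (map ?\<phi> (tower k))" "2 ^ k"]
      closed[OF w] closed[OF w'] closed[of "[?s]"] s by simp
  then show ?case using mult[of "[?s]" "tower k"] s w by simp
qed

section \<open>Interval reversals: the lower bound on the order\<close>

definition flip :: "nat \<Rightarrow> nat \<Rightarrow> nat \<Rightarrow> nat" where
  "flip p q i = (if p \<le> i \<and> i \<le> q then p + q - i else i)"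

primrec word_perm :: "(nat \<times> nat) group_word \<Rightarrow> nat \<Rightarrow> nat" where
  "word_perm [] i = i"
| "word_perm (a # w) i = flip (fst (fst a)) (snd (fst a)) (word_perm w i)"

lemma word_perm_append: "word_perm (u @ v) i = word_perm u (word_perm v i)"
  by (induction u) simp_all

lemma word_perm_replicate: "word_perm (concat (replicate m w)) i = (word_perm w ^^ m) i"
  by (induction m) (simp_all add: word_perm_append)

lemma flip_flip: "flip p q (flip p q i) = i"
  by (auto simp: flip_def)

text \<open>Interval reversals satisfy the cactus relations: this is the standard homomorphism from
  the cactus group to permutations.\<close>

lemma word_perm_cong: "(u, v) \<in> word_cong S (cactus_rels n) \<Longrightarrow> word_perm u i = word_perm v i"
proof (induction arbitrary: i rule: word_cong.induct)
  case (rel u v)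
  from rel(1) show ?case
  proof (cases rule: cactus_rels_cases)
    case (square p q)
    then show ?thesis by (simp add: flip_flip)
  next
    case (disjoint p q m r)
    then have "q < m \<or> r < p" by (auto simp: cactus_gens_def)
    then show ?thesis unfolding disjoint by (auto simp: flip_def)
  next
    case (nested p q m r)
    then show ?thesis by (auto simp: flip_def)
  qed
qed (simp_all add: word_perm_append flip_flip)

lemma word_perm_tower:
  "(1 \<le> i \<and> i \<le> 2 ^ k \<longrightarrow> 1 \<le> word_perm (tower k) i \<and> word_perm (tower k) i \<le> 2 ^ k)
    \<and> (2 ^ k < i \<longrightarrow> word_perm (tower k) i = i)"
proof (induction k)
  case (Suc k)
  then show ?case by (cases "i \<le> 2 ^ k") (auto simp: flip_def)
qed simp

text \<open>The first application ends in the upper half, which \<open>tower k\<close> fixes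
  pointwise; the second reversal then undoes the first.\<close>

lemma word_perm_tower_Suc_twice:
  assumes "1 \<le> i" "i \<le> 2 ^ k"
  shows "word_perm (tower (Suc k)) (word_perm (tower (Suc k)) i) = word_perm (tower k) i"
proof -
  let ?j = "word_perm (tower k) i" and ?q = "2 ^ Suc k :: nat"
  have j: "1 \<le> ?j" "?j \<le> 2 ^ k" using word_perm_tower[of i k] assms by auto
  then have fj: "flip 1 ?q ?j = 1 + ?q - ?j" by (simp add: flip_def)
  have "2 ^ k < flip 1 ?q ?j" unfolding fj using j by simp
  then have "word_perm (tower k) (flip 1 ?q ?j) = flip 1 ?q ?j" using word_perm_tower by blast
  then show ?thesis by (simp add: flip_flip del: power_Suc)
qed

text \<open>The orbit of 1 under the smaller tower stays in the lower half, where the larger tower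
  squared acts as the smaller one. Each level thus doubles the exponent, starting from the swap of 1
  and 2. As 1 is moved, this power of the tower is nontrivial.\<close>

lemma word_perm_tower_pow: "(word_perm (tower (Suc k)) ^^ (2 ^ k)) 1 = 2"
proof (induction k)
  case 0
  show ?case by (simp add: flip_def)
next
  case (Suc k)
  let ?T = "word_perm (tower (Suc (Suc k)))" and ?U = "word_perm (tower (Suc k))"
  have "(?T ^^ (2 * m)) 1 = (?U ^^ m) 1 \<and> 1 \<le> (?U ^^ m) 1 \<and> (?U ^^ m) 1 \<le> 2 ^ Suc k" for m
  proof (induction m)
    case (Suc m)
    let ?i = "(?U ^^ m) 1"
    have "(?T ^^ (2 * Suc m)) 1 = ?T (?T ((?T ^^ (2 * m)) 1))"
      by (simp del: tower.simps word_perm.simps)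
    also have "\<dots> = ?T (?T ?i)" using Suc by (simp only:)
    also have "\<dots> = ?U ?i" using Suc by (intro word_perm_tower_Suc_twice) (simp_all only:)
    finally have "(?T ^^ (2 * Suc m)) 1 = (?U ^^ Suc m) 1" by simp
    moreover have "1 \<le> ?U ?i \<and> ?U ?i \<le> 2 ^ Suc k"
      using Suc word_perm_tower[of ?i "Suc k"] by blast
    ultimately show ?case by (simp only: funpow.simps comp_apply)
  qed simp
  from this[of "2 ^ k"] show ?case using Suc by (simp del: tower.simps word_perm.simps)
qed

lemma (in group) ord_eq_two_power:
  assumes "x \<in> carrier G" "x [^] (2 ^ Suc k :: nat) = \<one>" "x [^] (2 ^ k :: nat) \<noteq> \<one>"
  shows "ord x = 2 ^ Suc k"
proof -
  have "ord x dvd 2 ^ Suc k" using assms pow_eq_id by blast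
  then obtain i where i: "i \<le> Suc k" "ord x = 2 ^ i"
    using divides_primepow_nat[OF two_is_prime_nat] by blast
  have "\<not> ord x dvd 2 ^ k" using assms pow_eq_id by blast
  then have "\<not> i \<le> k" using i(2) le_imp_power_dvd by metis
  with i show ?thesis by (simp add: le_Suc_eq)
qed

lemma ord_tower:
  assumes "2 ^ Suc k \<le> n"
  shows "group.ord (cactus_group n) (word_class (cactus_gens n) (cactus_rels n) (tower (Suc k))) = 2 ^ Suc k"
proof -
  interpret group "cactus_group n" by (rule group_cactus_group)
  let ?S = "cactus_gens n" and ?R = "cactus_rels n"
  let ?c = "word_class ?S ?R"
  have w: "tower (Suc k) \<in> words_over ?S" by (rule tower_words[OF assms])
  have "?c (tower (Suc k)) [^]\<^bsub>cactus_group n\<^esub> (2 ^ k :: nat) \<noteq> \<one>\<^bsub>cactus_group n\<^esub>"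
  proof
    let ?w = "concat (replicate (2 ^ k) (tower (Suc k)))"
    assume "?c (tower (Suc k)) [^]\<^bsub>cactus_group n\<^esub> (2 ^ k :: nat) = \<one>\<^bsub>cactus_group n\<^esub>"
    then have "?c ?w = ?c []"
      by (simp only: cactus_group_def one_presented_group word_class_replicate[OF w])
    moreover have "?w \<in> words_over ?S" using w by (auto simp: in_lists_conv_set simp del: tower.simps)
    ultimately have "(?w, []) \<in> word_cong ?S ?R" by (subst (asm) word_class_eq_iff) auto
    then have "word_perm ?w 1 = 1" using word_perm_cong[of ?w "[]"] by simp
    then show False by (simp only: word_perm_replicate word_perm_tower_pow)
  qed
  moreover have "?c (tower (Suc k)) \<in> carrier (cactus_group n)"
    unfolding cactus_group_def by (rule word_class_closed[OF w])
  ultimately show ?thesis using tower_pow_eq_one[OF assms] by (intro ord_eq_two_power)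
qed

theorem theoremB:
  shows "(\<forall>n\<ge>2. \<not> (\<exists>x\<in>carrier (cactus_group n).
            odd (group.ord (cactus_group n) x) \<and> group.ord (cactus_group n) x > 1))
       \<and> (\<forall>k\<ge>1. \<exists>N\<ge>2. \<forall>n\<ge>N. \<exists>x\<in>carrier (cactus_group n). group.ord (cactus_group n) x = 2 ^ k)"
proof (intro conjI allI impI notI)
  fix n :: nat
  interpret group "cactus_group n" by (rule group_cactus_group)
  assume "\<exists>x\<in>carrier (cactus_group n). odd (ord x) \<and> 1 < ord x"
  then obtain x where x: "x \<in> carrier (cactus_group n)" "odd (ord x)" "1 < ord x" by blast
  then have "x = \<one>\<^bsub>cactus_group n\<^esub>"
    using no_odd_torsion_cactus_group[of n] pow_ord_eq_1 unfolding no_odd_torsion_def by blast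
  with x(3) show False by simp
next
  fix k :: nat assume "1 \<le> k"
  then obtain j where k: "k = Suc j" by (cases k) auto
  have "\<exists>x\<in>carrier (cactus_group n). group.ord (cactus_group n) x = 2 ^ k" if "2 ^ k \<le> n" for n
    using ord_tower[of j n] tower_words[of k n] that word_class_closed
    unfolding k cactus_group_def by blast
  \<comment> \<open>The bound \<open>N\<close> is \<open>2 ^ k\<close>, the right end of the largest
    interval in the tower.\<close>
  moreover have "2 \<le> (2::nat) ^ k" by (simp add: k)
  ultimately show "\<exists>N\<ge>2. \<forall>n\<ge>N. \<exists>x\<in>carrier (cactus_group n). group.ord (cactus_group n) x = 2 ^ k"
    by blast
qed

end
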